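(* Let $\mathbf{B}$ be a spherically symmetric magnetic field, i.e. $\mathbf{B}(x)=B(r)\left(\frac{x_1}{r},\frac{x_2}{r},\frac{x_3}{r}\right)$ for $x\in\mathbb{R}^3\setminus\{0\}$, where $r=(x_1^2+x_2^2+x_3^2)^{1/2}$ and $B:(0,\infty)\to\mathbb{R}$ is continuously differentiable, and suppose that $\nabla\cdot\mathbf{B}=0$ on $\mathbb{R}^3\setminus\{0\}$. Then there is a constant $c$ such that $B(r)=c/r^2$. If $B$ is bounded as $r\to0^+$, then $B(r)=0$ for all $r>0$. If $c\neq0$, then for every $R>0$ the magnetic energy in the ball $B_R\subset\mathbb{R}^3$ of radius $R$ centered at the origin is infinite: $$\frac{1}{8\pi}\int_{B_R}|\mathbf{B}|^2\,dx=\infty.$$ *)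

theory Defs
  imports "HOL-Analysis.Analysis"
begin

text \<open>Since \<^term>\<open>deriv\<close> is total, \<open>partial_deriv\<close> and \<open>divergence\<close> have
  their intended meaning only where the partial derivatives involved exist.\<close>

definition partial_deriv :: "'n \<Rightarrow> (real ^ 'n \<Rightarrow> real) \<Rightarrow> real ^ 'n \<Rightarrow> real"
  where "partial_deriv i f x = deriv (\<lambda>t. f (x + t *\<^sub>R axis i 1)) 0"

definition divergence :: "(real ^ 'n \<Rightarrow> real ^ 'n) \<Rightarrow> real ^ 'n \<Rightarrow> real"
  where "divergence F x = (\<Sum>i\<in>UNIV. partial_deriv i (\<lambda>y. F y $ i) x)"

text \<open>The value of the field at the origin is left unspecified.\<close>

definition spherically_symmetric_field :: "(real ^ 3 \<Rightarrow> real ^ 3) \<Rightarrow> (real \<Rightarrow> real) \<Rightarrow> bool"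
  where "spherically_symmetric_field F B \<longleftrightarrow>
    B C1_differentiable_on {0<..} \<and>
    (\<forall>x. x \<noteq> 0 \<longrightarrow> F x = B (norm x) *\<^sub>R (\<chi> i. x $ i / norm x))"

text \<open>A Lebesgue integral with values in \<^typ>\<open>ennreal\<close>, so that infinite energy is
  represented by the value \<open>\<infinity>\<close>.\<close>

definition magnetic_energy :: "(real ^ 3 \<Rightarrow> real ^ 3) \<Rightarrow> (real ^ 3) set \<Rightarrow> ennreal"
  where "magnetic_energy F S =
    ennreal (1 / (8 * pi)) * (\<integral>\<^sup>+ x\<in>S. ennreal ((norm (F x))\<^sup>2) \<partial>lborel)"

end

theory Submission
  imports Defs
begin

text \<open>It suffices to evaluate the divergence at the points \<open>r e\<^sub>k\<close> of one coordinate axis.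
  There the \<open>k\<close>-th component of the field, moved along the axis, is \<open>B\<close> itself, and every
  other component, moved in its own direction, is the displacement \<open>t\<close> times a function continuous
  at \<open>t = 0\<close> with value \<open>B r / r\<close>.  So in \<open>\<real>\<^sup>n\<close> the divergence is \<open>B' r + (n - 1) B r / r\<close>
  (\<open>divergence_radial_axis\<close>), and for \<open>n = 3\<close> its vanishing says that \<open>r\<^sup>2 B r\<close> has derivative
  zero.  This gives \<open>B r = c / r\<^sup>2\<close>, which is bounded near \<open>0\<close> only for \<open>c = 0\<close>.

  If \<open>c \<noteq> 0\<close>, the energy density is a positive multiple of \<open>1 / |x|\<^sup>4\<close>.  On the ball of radius \<open>s\<close> it is at least of
  order \<open>1 / s\<^sup>4\<close>, while the volume is of order \<open>s\<^sup>3\<close>; so the energy in every ball around the origin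
  exceeds a positive multiple of \<open>1 / s\<close> for all small \<open>s\<close>
  (\<open>nn_integral_inverse_power_ball\<close>).\<close>

section \<open>The divergence of a radial field\<close>

text \<open>The difference quotient at \<open>0\<close> is \<open>g\<close> itself, so continuity of \<open>g\<close> suffices.  This spares
  differentiating the norm in the directions orthogonal to the axis.\<close>

lemma has_real_derivative_times_continuous:
  fixes g :: "real \<Rightarrow> real"
  assumes "isCont g 0"
  shows "((\<lambda>t. t * g t) has_real_derivative g 0) (at 0)"
proof -
  have "((\<lambda>h. (h * g h) / h) \<longlongrightarrow> g 0) (at 0)"
    by (rule Lim_transform_eventually[OF assms[unfolded isCont_def]])
      (auto simp: eventually_at_filter)
  then show ?thesis
    by (simp add: DERIV_def)
qed

lemma divergence_radial_axis:
  fixes F :: "real ^ 'n::finite \<Rightarrow> real ^ 'n" and B :: "real \<Rightarrow> real" and k :: 'n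
  assumes F: "\<And>x. x \<noteq> 0 \<Longrightarrow> F x = B (norm x) *\<^sub>R (\<chi> i. x $ i / norm x)"
    and B: "(B has_real_derivative D) (at r)" and r: "r > 0"
  shows "divergence F (r *\<^sub>R axis k 1) = D + real (CARD('n) - 1) * (B r / r)"
proof -
  let ?x = "r *\<^sub>R axis k 1 :: real ^ 'n"
  have along: "partial_deriv k (\<lambda>y. F y $ k) ?x = D"
  proof -
    have "((\<lambda>t. B (r + t)) has_real_derivative D) (at 0)"
      using B DERIV_shift[of B D 0 r] by (simp add: add.commute)
    moreover have "eventually (\<lambda>t. B (r + t) = F (?x + t *\<^sub>R axis k 1) $ k) (nhds 0)"
    proof -
      have "eventually (\<lambda>t. - r < t) (nhds (0::real))"
        using r by (intro eventually_nhds_in_open[of "{- r<..}", simplified]) auto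
      then show ?thesis
      proof eventually_elim
        case (elim t)
        have eq: "?x + t *\<^sub>R axis k 1 = (r + t) *\<^sub>R axis k 1"
          by (simp add: scaleR_left_distrib)
        have n: "norm ((r + t) *\<^sub>R axis k 1 :: real ^ 'n) = r + t"
          using elim by (simp add: norm_axis_1)
        have "(r + t) *\<^sub>R axis k 1 \<noteq> (0 :: real ^ 'n)"
          using elim n by (metis add.commute add_less_cancel_left norm_zero
            add.right_inverse less_irrefl)
        from F[OF this] show ?case
          using elim unfolding eq n by (simp add: axis_def)
      qed
    qed
    ultimately have "((\<lambda>t. F (?x + t *\<^sub>R axis k 1) $ k) has_real_derivative D) (at 0)"
      by (rule iffD1[OF DERIV_cong_ev[OF refl _ refl], rotated])
    then show ?thesis
      unfolding partial_deriv_def by (rule DERIV_imp_deriv)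
  qed
  have across: "partial_deriv i (\<lambda>y. F y $ i) ?x = B r / r" if "i \<noteq> k" for i
  proof -
    define g where "g t = B (norm (?x + t *\<^sub>R axis i 1)) / norm (?x + t *\<^sub>R axis i 1)" for t
    have nz: "?x + t *\<^sub>R axis i 1 \<noteq> 0" for t
    proof
      assume "?x + t *\<^sub>R axis i 1 = 0"
      then have "(?x + t *\<^sub>R axis i 1) $ k = 0" by simp
      then show False using that r by (simp add: axis_def)
    qed
    have norm_x: "norm ?x = r"
      using r by (simp add: norm_axis_1)
    have "isCont (\<lambda>t. B (norm (?x + t *\<^sub>R axis i 1))) 0"
      by (rule isCont_o2[where g = B]) (use DERIV_isCont[OF B] norm_x in auto)
    then have "isCont g 0"
      unfolding g_def by (intro continuous_intros) (use nz in auto)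
    then have "((\<lambda>t. t * g t) has_real_derivative g 0) (at 0)"
      by (rule has_real_derivative_times_continuous)
    moreover have "(\<lambda>t. F (?x + t *\<^sub>R axis i 1) $ i) = (\<lambda>t. t * g t)"
    proof
      fix t
      have "(?x + t *\<^sub>R axis i 1) $ i = t"
        using that by (simp add: axis_def)
      then show "F (?x + t *\<^sub>R axis i 1) $ i = t * g t"
        by (simp add: F[OF nz] g_def del: vector_add_component)
    qed
    moreover have "g 0 = B r / r"
      using norm_x by (simp add: g_def)
    ultimately show ?thesis
      unfolding partial_deriv_def by (auto intro: DERIV_imp_deriv)
  qed
  have "divergence F ?x = partial_deriv k (\<lambda>y. F y $ k) ?x
      + (\<Sum>i\<in>UNIV - {k}. partial_deriv i (\<lambda>y. F y $ i) ?x)"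
    unfolding divergence_def by (rule sum.remove) auto
  also have "\<dots> = D + (\<Sum>i\<in>UNIV - {k}. B r / r)"
    unfolding along by (simp add: across)
  also have "\<dots> = D + real (CARD('n) - 1) * (B r / r)"
    by (simp add: card_Diff_singleton)
  finally show ?thesis .
qed

section \<open>The inverse square law\<close>

text \<open>The integrating factor of this differential equation is \<open>r\<^sup>2\<close>; physically, the flux through
  the sphere of radius \<open>r\<close> does not depend on \<open>r\<close>.\<close>

lemma inverse_square_law:
  fixes B :: "real \<Rightarrow> real"
  assumes "\<And>r. r > 0 \<Longrightarrow> (B has_real_derivative - 2 * B r / r) (at r)" and "r > 0"
  shows "B r = B 1 / r\<^sup>2"
proof -
  have "\<exists>c. \<forall>x\<in>{0<..}. x\<^sup>2 * B x = c"
  proof (rule has_field_derivative_zero_constant)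
    fix x :: real assume "x \<in> {0<..}"
    then have x: "x > 0" by simp
    have "((\<lambda>x. x\<^sup>2 * B x) has_real_derivative 2 * x * B x + x\<^sup>2 * (- 2 * B x / x)) (at x)"
      by (rule derivative_eq_intros assms(1)[OF x] | simp)+
    moreover have "2 * x * B x + x\<^sup>2 * (- 2 * B x / x) = 0"
      using x by (simp add: field_simps power2_eq_square)
    ultimately show "((\<lambda>x. x\<^sup>2 * B x) has_real_derivative 0) (at x within {0<..})"
      by (simp add: has_field_derivative_at_within)
  qed simp
  then obtain c where "\<And>x. x > 0 \<Longrightarrow> x\<^sup>2 * B x = c" by auto
  from this[of 1] this[OF \<open>r > 0\<close>] show ?thesis
    using \<open>r > 0\<close> by (simp add: field_simps)
qed

lemma bounded_inverse_square_imp_zero: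
  fixes B :: "real \<Rightarrow> real"
  assumes B: "\<And>r. r > 0 \<Longrightarrow> B r = c / r\<^sup>2" and bdd: "Bfun B (at_right 0)"
  shows "c = 0"
proof -
  have "((\<lambda>r. r\<^sup>2) \<longlongrightarrow> (0::real)) (at_right 0)"
    by (auto intro!: tendsto_eq_intros)
  then have "((\<lambda>r. r\<^sup>2 * B r) \<longlongrightarrow> 0) (at_right 0)"
    using bdd by (simp add: tendsto_Zfun_iff
      bounded_bilinear.Zfun_prod_Bfun[OF bounded_bilinear_mult])
  moreover have "eventually (\<lambda>r. r\<^sup>2 * B r = c) (at_right 0)"
    using B by (auto simp: eventually_at_filter)
  ultimately have "((\<lambda>r::real. c) \<longlongrightarrow> 0) (at_right 0)"
    by (rule Lim_transform_eventually)
  then show ?thesis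
    by (simp add: tendsto_const_iff)
qed

section \<open>Divergence of the energy integral\<close>

text \<open>Comparison with the value on the boundary of a smaller ball of radius \<open>s\<close> bounds the integral
  from below by a multiple of \<open>s\<^sup>n / s\<^sup>p\<close>, where \<open>n\<close> is the dimension; letting \<open>s\<close> tend to
  \<open>0\<close> replaces an integration in polar coordinates.\<close>

lemma nn_integral_inverse_power_ball:
  fixes a R :: real
  assumes p: "DIM('a::euclidean_space) < p" and a: "a > 0" and R: "R > 0"
  shows "(\<integral>\<^sup>+ x\<in>ball (0::'a) R. ennreal (a / norm x ^ p) \<partial>lborel) = \<infinity>" (is "?I = \<infinity>")
proof -
  define K where "K = a * unit_ball_vol (real DIM('a))"
  have K: "K > 0"
    using a by (simp add: K_def unit_ball_vol_pos)
  \<comment> \<open>For \<open>s \<le> 1\<close> the worst case is \<open>p = n + 1\<close>, in which the bound is exactly \<open>K / s\<close>.\<close>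
  have lower: "ennreal (K / s) \<le> ?I" if s: "0 < s" "s < R" "s \<le> 1" for s
  proof -
    have "K / s \<le> a / s ^ p * (unit_ball_vol (real DIM('a)) * s ^ DIM('a))"
    proof -
      obtain d where d: "p = Suc (DIM('a) + d)"
        using p less_iff_Suc_add by auto
      have "K / s \<le> K / (s * s ^ d)"
        using s K by (intro divide_left_mono) (auto simp: power_le_one mult_le_cancel_left1)
      also have "\<dots> = a / s ^ p * (unit_ball_vol (real DIM('a)) * s ^ DIM('a))"
        using s by (simp add: K_def d power_add field_simps)
      finally show ?thesis .
    qed
    then have "ennreal (K / s)
        \<le> ennreal (a / s ^ p) * ennreal (unit_ball_vol (real DIM('a)) * s ^ DIM('a))"
      using a s by (simp flip: ennreal_mult)
    also have "\<dots> = ennreal (a / s ^ p) * emeasure lborel (ball (0::'a) s)"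
      using s by (simp add: emeasure_ball)
    also have "\<dots> = (\<integral>\<^sup>+ x. ennreal (a / s ^ p) * indicator (ball (0::'a) s) x \<partial>lborel)"
      by (simp add: nn_integral_cmult_indicator)
    also have "\<dots> \<le> ?I"
    proof (rule nn_integral_mono_AE)
      show "AE x in lborel. ennreal (a / s ^ p) * indicator (ball (0::'a) s) x
          \<le> ennreal (a / norm x ^ p) * indicator (ball 0 R) x"
        using AE_lborel_singleton[of "0::'a"]
      proof eventually_elim
        case (elim x)
        then show ?case
          using s a by (auto simp: indicator_def intro!: ennreal_leI divide_left_mono power_mono)
      qed
    qed
    finally show ?thesis .
  qed
  have "((\<lambda>s. ennreal (K / s)) \<longlongrightarrow> \<infinity>) (at_right 0)"
  proof -
    have "filterlim (\<lambda>s. K * inverse s) at_top (at_right 0)"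
      using K by (intro filterlim_tendsto_pos_mult_at_top[OF tendsto_const])
        (auto intro: filterlim_inverse_at_top_right)
    then show ?thesis
      by (simp add: ennreal_tendsto_top_eq_at_top divide_inverse)
  qed
  moreover have "eventually (\<lambda>s. ennreal (K / s) \<le> ?I) (at_right 0)"
    using eventually_at_right_real[of 0 "min R 1"] R
    by (auto elim!: eventually_mono intro!: lower)
  ultimately have "\<infinity> \<le> ?I"
    by (rule tendsto_upperbound) simp
  then show ?thesis
    by (simp add: top_unique)
qed

section \<open>Spherically symmetric magnetic fields\<close>

theorem mainTheorem4:
  fixes F :: "real ^ 3 \<Rightarrow> real ^ 3" and B :: "real \<Rightarrow> real"
  assumes "spherically_symmetric_field F B"
    and "\<forall>x. x \<noteq> 0 \<longrightarrow> divergence F x = 0"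
  shows "\<exists>c. (\<forall>r>0. B r = c / r\<^sup>2) \<and>
    (Bfun B (at_right 0) \<longrightarrow> (\<forall>r>0. B r = 0)) \<and>
    (c \<noteq> 0 \<longrightarrow> (\<forall>R>0. magnetic_energy F (ball 0 R) = \<infinity>))"
proof -
  have F: "F x = B (norm x) *\<^sub>R (\<chi> i. x $ i / norm x)" if "x \<noteq> 0" for x
    using assms(1) that by (simp add: spherically_symmetric_field_def)
  have ode: "(B has_real_derivative - 2 * B r / r) (at r)" if r: "r > 0" for r
  proof -
    have "B differentiable at r"
      using assms(1) r C1_differentiable_on_eq[of B "{0<..}"]
      by (auto simp: spherically_symmetric_field_def)
    then obtain D where D: "(B has_real_derivative D) (at r)"
      by (auto simp: real_differentiable_def)
    have "r *\<^sub>R axis 1 1 \<noteq> (0 :: real ^ 3)"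
      using r by (simp add: axis_eq_0_iff)
    then have "D + 2 * (B r / r) = 0"
      using divergence_radial_axis[of F B D r 1, OF F D r] assms(2) by simp
    then have "D = - 2 * B r / r"
      by simp
    with D show ?thesis by simp
  qed
  define c where "c = B 1"
  have law: "B r = c / r\<^sup>2" if "r > 0" for r
    unfolding c_def using ode that by (rule inverse_square_law)
  have "B r = 0" if "Bfun B (at_right 0)" "r > 0" for r
    using bounded_inverse_square_imp_zero[OF law that(1)] law[OF that(2)] by simp
  moreover have "magnetic_energy F (ball 0 R) = \<infinity>" if c: "c \<noteq> 0" and R: "R > 0" for R
  proof -
    have density: "(norm (F x))\<^sup>2 = c\<^sup>2 / norm x ^ 4" if x: "x \<noteq> 0" for x
    proof -
      have "(\<chi> i. x $ i / norm x) = x /\<^sub>R norm x"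
        by (simp add: vec_eq_iff divide_inverse mult.commute)
      then have "norm (F x) = \<bar>c\<bar> / (norm x)\<^sup>2"
        using x by (simp add: F law abs_mult field_simps power2_eq_square)
      then show ?thesis
        by (simp add: power_divide flip: power_mult)
    qed
    have "(\<integral>\<^sup>+ x\<in>ball 0 R. ennreal ((norm (F x))\<^sup>2) \<partial>lborel)
        = (\<integral>\<^sup>+ x\<in>ball (0 :: real ^ 3) R. ennreal (c\<^sup>2 / norm x ^ 4) \<partial>lborel)"
      using AE_lborel_singleton[of "0 :: real ^ 3"]
      by (intro nn_integral_cong_AE) (auto elim!: eventually_mono simp: density)
    also have "\<dots> = \<infinity>"
      using c R by (intro nn_integral_inverse_power_ball) auto
    finally show ?thesis
      by (simp add: magnetic_energy_def ennreal_mult_top)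
  qed
  ultimately show ?thesis
    using law by blast
qed

end
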